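(* Let $\lambda>0$, $r>0$, $v_{01}>0$, $v_{02}>0$, $h(x)=x_1^2+x_2^2-r^2$, $\|x\|^2=x_1^2+x_2^2$, and consider on $\mathbb R^2\setminus\{0\}$ the system $$\dot x_1=-\frac{\lambda x_1}{2\|x\|^2}h(x)+\frac{x_2^2}{\|x\|^2}v_{01}-\frac{x_1x_2}{\|x\|^2}v_{02},\qquad \dot x_2=-\frac{\lambda x_2}{2\|x\|^2}h(x)-\frac{x_1x_2}{\|x\|^2}v_{01}+\frac{x_1^2}{\|x\|^2}v_{02}.$$ Then: (i) in the open quadrant $\{x_1<0,\ x_2<0\}$ the set of equilibria is the intersection of the arc $h(x)=0$ with the line $x_2v_{01}-x_1v_{02}=0$, which is the single point $x_e$ with coordinates $$x_{ie}=-\frac{v_{0i}\,r}{\sqrt{v_{01}^2+v_{02}^2}},\qquad i=1,2;$$ (ii) the Jacobian matrix of the right-hand side at $x_e$ has eigenvalues $-\lambda$ and $\dfrac{\sqrt{v_{01}^2+v_{02}^2}}{r}>0$; in particular $x_e$ is an unstable equilibrium; (iii) the set of initial conditions in $\{x_1<0,\ x_2<0\}$ whose solution converges to $x_e$ as $t\to\infty$ has Lebesgue measure zero.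
   Context: The system is the joint closed-loop dynamics of two agents on perpendicular lines, $\dot x_i=v_i$ ($i=1,2$, $x_i$ the signed distance from the intersection point, $v_{0i}>0$ the constant desired velocity), under the Centralized collision avoidance policy when the constraint is active: minimize $\|v_1-v_{01}\|^2+\|v_2-v_{02}\|^2$ over $(v_1,v_2)$ subject to $\lambda h+2x_1v_1+2x_2v_2\ge 0$. The claim itself concerns only the displayed differential equation. *)

theory Defs
  imports "HOL-Analysis.Analysis"
begin

definition solves_on ::
    "(real^'n \<Rightarrow> real^'n) \<Rightarrow> (real^'n) set \<Rightarrow> (real \<Rightarrow> real^'n) \<Rightarrow> real set \<Rightarrow> bool" where
  "solves_on f D x I \<longleftrightarrow>
     (\<forall>t\<in>I. x t \<in> D \<and> (x has_vector_derivative f (x t)) (at t within I))"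

definition equilibrium :: "(real^'n \<Rightarrow> real^'n) \<Rightarrow> (real^'n) set \<Rightarrow> real^'n \<Rightarrow> bool" where
  "equilibrium f D p \<longleftrightarrow> p \<in> D \<and> f p = 0"

text \<open>Lyapunov stability. All forward solutions are tested, including those defined only on a
  compact time interval, so that no global existence is presupposed.\<close>

definition stable_equilibrium :: "(real^'n \<Rightarrow> real^'n) \<Rightarrow> (real^'n) set \<Rightarrow> real^'n \<Rightarrow> bool" where
  "stable_equilibrium f D p \<longleftrightarrow> equilibrium f D p \<and>
     (\<forall>\<epsilon>>0. \<exists>\<delta>>0. \<forall>T>0. \<forall>x. solves_on f D x {0..T} \<and> dist (x 0) p < \<delta> \<longrightarrow>
        (\<forall>t\<in>{0..T}. dist (x t) p < \<epsilon>))"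

definition unstable_equilibrium :: "(real^'n \<Rightarrow> real^'n) \<Rightarrow> (real^'n) set \<Rightarrow> real^'n \<Rightarrow> bool" where
  "unstable_equilibrium f D p \<longleftrightarrow> equilibrium f D p \<and> \<not> stable_equilibrium f D p"

text \<open>The existential is harmless for locally Lipschitz fields, where the solution is unique.\<close>

definition converges_from ::
    "(real^'n \<Rightarrow> real^'n) \<Rightarrow> (real^'n) set \<Rightarrow> real^'n \<Rightarrow> real^'n \<Rightarrow> bool" where
  "converges_from f D x0 p \<longleftrightarrow>
     (\<exists>x. solves_on f D x {0..} \<and> x 0 = x0 \<and> (x \<longlongrightarrow> p) at_top)"

definition eigenvalue :: "'a::field^'n^'n \<Rightarrow> 'a \<Rightarrow> bool" where
  "eigenvalue A c \<longleftrightarrow> (\<exists>v. v \<noteq> 0 \<and> A *v v = c *s v)"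

text \<open>The collision-avoidance function (squared distance minus squared safety radius); x$1 and x$2 are
  the signed distances of the two agents from the intersection point of their lines.\<close>

definition h :: "real \<Rightarrow> real^2 \<Rightarrow> real" where
  "h r x = (x$1)\<^sup>2 + (x$2)\<^sup>2 - r\<^sup>2"

definition closed_loop :: "real \<Rightarrow> real \<Rightarrow> real \<Rightarrow> real \<Rightarrow> real^2 \<Rightarrow> real^2" where
  "closed_loop lam r v01 v02 x = vector
     [ - (lam * x$1 / (2 * (norm x)\<^sup>2)) * h r x
         + (x$2)\<^sup>2 / (norm x)\<^sup>2 * v01 - x$1 * x$2 / (norm x)\<^sup>2 * v02,
       - (lam * x$2 / (2 * (norm x)\<^sup>2)) * h r x
         - x$1 * x$2 / (norm x)\<^sup>2 * v01 + (x$1)\<^sup>2 / (norm x)\<^sup>2 * v02 ]"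

definition phase_space :: "(real^2) set" where
  "phase_space = UNIV - {0}"

definition negative_quadrant :: "(real^2) set" where
  "negative_quadrant = {x. x$1 < 0 \<and> x$2 < 0}"

definition x_eq :: "real \<Rightarrow> real \<Rightarrow> real \<Rightarrow> real^2" where
  "x_eq r v01 v02 = vector
     [ - (v01 * r / sqrt (v01\<^sup>2 + v02\<^sup>2)), - (v02 * r / sqrt (v01\<^sup>2 + v02\<^sup>2)) ]"

end

theory Submission
  imports Defs
begin

text \<open>Write \<open>w(x) = x\<^sub>2 v\<^sub>0\<^sub>1 - x\<^sub>1 v\<^sub>0\<^sub>2\<close>. The field is \<open>-\<lambda>h/(2\<parallel>x\<parallel>\<^sup>2)\<close> times the radial vector \<open>x\<close> plus
  \<open>w/\<parallel>x\<parallel>\<^sup>2\<close> times the tangential vector \<open>(x\<^sub>2, -x\<^sub>1)\<close>. Both coefficients vanish exactly at the equilibria,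
  so the Jacobian there is the sum of two rank-one matrices with orthogonal ranges. Along solutions
  \<open>w' = b w\<close>, where \<open>b\<close> tends to \<open>\<parallel>v\<^sub>0\<parallel>/r > 0\<close> if the solution converges to \<open>x\<^sub>e\<close>; then \<open>w\<^sup>2\<close>
  eventually increases to \<open>0\<close>, which forces \<open>w = 0\<close> at all times. So the stable
  set lies on the line \<open>w = 0\<close>. Instability is witnessed by explicit solutions on
  the invariant circle \<open>h = 0\<close>.\<close>

section \<open>Radial and tangential components of the field\<close>

definition transversal :: "real \<Rightarrow> real \<Rightarrow> real^2 \<Rightarrow> real" where
  "transversal v01 v02 x = x$2 * v01 - x$1 * v02"

definition clockwise :: "real^2 \<Rightarrow> real^2" where
  "clockwise x = vector [x$2, - x$1]"

lemma clockwise_nth [simp]: "clockwise x $ 1 = x$2" "clockwise x $ 2 = - x$1"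
  by (simp_all add: clockwise_def)

lemma linear_clockwise: "linear clockwise"
  by (rule linearI) (simp_all add: vec_eq_iff forall_2)

lemma linear_transversal: "linear (transversal v01 v02)"
  by (rule linearI) (simp_all add: transversal_def algebra_simps)

lemma norm_power2_vec2: "(norm (x::real^2))\<^sup>2 = (x$1)\<^sup>2 + (x$2)\<^sup>2"
  unfolding power2_norm_eq_inner by (simp add: inner_vec_def sum_2 power2_eq_square)

lemma h_eq_norm: "h r x = (norm x)\<^sup>2 - r\<^sup>2"
  by (simp add: h_def norm_power2_vec2)

text \<open>The terms in \<open>v01\<close> and \<open>v02\<close> form the orthogonal projection of
  the desired velocity onto the direction \<open>clockwise x\<close>, because
  \<open>transversal v01 v02 x\<close> is the inner product of (\<open>v01\<close>,
  \<open>v02\<close>) with \<open>clockwise x\<close>. At \<open>x = 0\<close> both sides vanish,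
  since division by zero yields 0.\<close>

lemma closed_loop_decomposition:
  "closed_loop lam r v01 v02 x =
     (- (lam * h r x / (2 * (norm x)\<^sup>2))) *\<^sub>R x
     + (transversal v01 v02 x / (norm x)\<^sup>2) *\<^sub>R clockwise x"
  by (simp add: closed_loop_def transversal_def vec_eq_iff forall_2 power2_eq_square
      algebra_simps diff_divide_distrib)

text \<open>\<open>x\<close> and \<open>clockwise x\<close> are orthogonal and equally long, so
  these inner products isolate the two coefficients of the decomposition. A zero of the field
  therefore makes both coefficients vanish.\<close>

lemma inner_closed_loop:
  assumes "x \<noteq> 0"
  shows "closed_loop lam r v01 v02 x \<bullet> x = - (lam * h r x / 2)"
    and "closed_loop lam r v01 v02 x \<bullet> clockwise x = transversal v01 v02 x"
proof -
  have [simp]: "clockwise x \<bullet> x = 0" "x \<bullet> clockwise x = 0"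
    "(norm (clockwise x))\<^sup>2 = (norm x)\<^sup>2"
    by (simp_all add: inner_vec_def sum_2 norm_power2_vec2)
  show "closed_loop lam r v01 v02 x \<bullet> x = - (lam * h r x / 2)"
    and "closed_loop lam r v01 v02 x \<bullet> clockwise x = transversal v01 v02 x"
    using assms
    by (simp_all add: closed_loop_decomposition inner_add_left inner_diff_left power2_norm_eq_inner[symmetric])
qed

lemma equilibrium_closed_loop_iff:
  assumes "lam > 0" "x \<noteq> 0"
  shows "equilibrium (closed_loop lam r v01 v02) phase_space x
    \<longleftrightarrow> h r x = 0 \<and> transversal v01 v02 x = 0"
proof
  assume "equilibrium (closed_loop lam r v01 v02) phase_space x"
  then have "closed_loop lam r v01 v02 x = 0" by (simp add: equilibrium_def)
  then show "h r x = 0 \<and> transversal v01 v02 x = 0"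
    using inner_closed_loop[OF assms(2), of lam r v01 v02] assms(1) by auto
next
  assume "h r x = 0 \<and> transversal v01 v02 x = 0"
  then show "equilibrium (closed_loop lam r v01 v02) phase_space x"
    using assms(2) by (simp add: equilibrium_def phase_space_def closed_loop_decomposition)
qed

section \<open>Linearization at a common zero of both coefficients\<close>

lemma has_derivative_scaleR_at_zero:
  assumes "(g has_derivative g') (at a)" "g a = 0" "(y has_derivative y') (at a)"
  shows "((\<lambda>x. g x *\<^sub>R y x) has_derivative (\<lambda>d. g' d *\<^sub>R y a)) (at a)"
  using has_derivative_scaleR[OF assms(1,3)] assms(2) by simp

lemma has_derivative_divide_at_zero:
  fixes g :: "'a::real_normed_vector \<Rightarrow> real"
  assumes "(g has_derivative g') (at a)" "g a = 0" "(k has_derivative k') (at a)" "k a \<noteq> 0"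
  shows "((\<lambda>x. g x / k x) has_derivative (\<lambda>d. g' d / k a)) (at a)"
  using has_derivative_divide'[OF assms(1,3,4)] assms(2,4)
  by (simp add: field_simps)

text \<open>Both scalar coefficients vanish at \<open>p\<close>, so the product and quotient rules
  retain only the derivatives of the numerators \<open>h\<close> and \<open>transversal\<close>;
  denominators and direction vectors are frozen at \<open>p\<close>.\<close>

lemma closed_loop_has_derivative_at_equilibrium:
  assumes "h r p = 0" "transversal v01 v02 p = 0" "p \<noteq> 0"
  shows "(closed_loop lam r v01 v02 has_derivative
     (\<lambda>d. (- (lam * (p \<bullet> d) / (norm p)\<^sup>2)) *\<^sub>R p
          + (transversal v01 v02 d / (norm p)\<^sup>2) *\<^sub>R clockwise p)) (at p)"
proof -
  have sq: "((\<lambda>x. (norm x)\<^sup>2) has_derivative (\<lambda>d. 2 * (p \<bullet> d))) (at p)"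
    unfolding power2_norm_eq_inner
    by (auto intro!: derivative_eq_intros simp: inner_commute)
  have hd: "((\<lambda>x. - (lam * h r x)) has_derivative (\<lambda>d. - (lam * (2 * (p \<bullet> d))))) (at p)"
    unfolding h_eq_norm by (auto intro!: derivative_eq_intros sq)
  have sq2: "((\<lambda>x. 2 * (norm x)\<^sup>2) has_derivative (\<lambda>d. 2 * (2 * (p \<bullet> d)))) (at p)"
    by (auto intro!: derivative_eq_intros sq)
  have wd: "(transversal v01 v02 has_derivative transversal v01 v02) (at p)"
    by (rule linear_imp_has_derivative[OF linear_transversal])
  have cd: "(clockwise has_derivative clockwise) (at p)"
    by (rule linear_imp_has_derivative[OF linear_clockwise])
  have n: "2 * (norm p)\<^sup>2 \<noteq> 0" "(norm p)\<^sup>2 \<noteq> 0" using assms(3) by auto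
  have 1: "((\<lambda>x. (- (lam * h r x) / (2 * (norm x)\<^sup>2)) *\<^sub>R x) has_derivative
      (\<lambda>d. (- (lam * (2 * (p \<bullet> d))) / (2 * (norm p)\<^sup>2)) *\<^sub>R p)) (at p)"
    by (rule has_derivative_scaleR_at_zero[OF has_derivative_divide_at_zero[OF hd _ sq2 n(1)]
          _ has_derivative_ident]) (simp_all add: assms(1))
  have 2: "((\<lambda>x. (transversal v01 v02 x / (norm x)\<^sup>2) *\<^sub>R clockwise x) has_derivative
      (\<lambda>d. (transversal v01 v02 d / (norm p)\<^sup>2) *\<^sub>R clockwise p)) (at p)"
    by (rule has_derivative_scaleR_at_zero[OF has_derivative_divide_at_zero[OF wd assms(2) sq n(2)]
          _ cd]) (simp add: assms(2))
  have "closed_loop lam r v01 v02 = (\<lambda>x. (- (lam * h r x) / (2 * (norm x)\<^sup>2)) *\<^sub>R x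
     + (transversal v01 v02 x / (norm x)\<^sup>2) *\<^sub>R clockwise x)"
    by (rule ext) (simp add: closed_loop_decomposition)
  then show ?thesis
    using has_derivative_add[OF 1 2] by simp
qed

section \<open>The equilibrium in the open quadrant\<close>

context
  fixes r v01 v02 :: real
  assumes r: "r > 0" and v: "v01 > 0" "v02 > 0"
begin

private definition "V = sqrt (v01\<^sup>2 + v02\<^sup>2)"

private abbreviation (input) "xe \<equiv> x_eq r v01 v02"

private lemma V_pos: "V > 0" and V_sq: "V\<^sup>2 = v01\<^sup>2 + v02\<^sup>2"
  using v by (simp_all add: V_def add_pos_pos)

private lemma x_eq_nth: "xe $ 1 = - (v01 * r / V)" "xe $ 2 = - (v02 * r / V)"
  by (simp_all add: x_eq_def V_def)

lemma h_x_eq: "h r xe = 0"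
proof -
  have "(v01 * r / V)\<^sup>2 + (v02 * r / V)\<^sup>2 = (v01\<^sup>2 + v02\<^sup>2) * r\<^sup>2 / V\<^sup>2"
    by (simp add: power_mult_distrib power_divide algebra_simps add_divide_distrib)
  then show ?thesis
    using V_pos by (simp add: h_def x_eq_nth flip: V_sq)
qed

lemma norm_x_eq: "norm xe = r"
  using h_x_eq r by (simp add: h_eq_norm)

lemma transversal_x_eq: "transversal v01 v02 xe = 0"
  by (simp add: transversal_def x_eq_nth)

lemma x_eq_nonzero: "xe \<noteq> 0"
  using norm_x_eq r by auto

lemma x_eq_in_quadrant: "xe \<in> negative_quadrant"
  using r v V_pos by (simp add: negative_quadrant_def x_eq_nth)

text \<open>The circle and the line together determine the square of each coordinate; the signs in
  the quadrant select the root.\<close>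

lemma equilibrium_unique:
  "{x \<in> negative_quadrant. h r x = 0} \<inter> {x. x$2 * v01 - x$1 * v02 = 0} = {xe}"
proof (intro equalityI subsetI)
  fix x assume "x \<in> {x \<in> negative_quadrant. h r x = 0} \<inter> {x. x$2 * v01 - x$1 * v02 = 0}"
  then have neg: "x$1 < 0" "x$2 < 0" and h: "(x$1)\<^sup>2 + (x$2)\<^sup>2 = r\<^sup>2"
    and w: "x$2 * v01 = x$1 * v02"
    by (simp_all add: negative_quadrant_def h_def)
  have e1: "(- x$1 * V)\<^sup>2 = (v01 * r)\<^sup>2"
  proof -
    have "(- x$1 * V)\<^sup>2 = (x$1 * v01)\<^sup>2 + (x$1 * v02)\<^sup>2"
      using V_sq by (simp add: power_mult_distrib algebra_simps)
    also have "\<dots> = v01\<^sup>2 * ((x$1)\<^sup>2 + (x$2)\<^sup>2)"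
      unfolding w[symmetric] by (simp add: power_mult_distrib algebra_simps)
    finally show ?thesis by (simp add: h power_mult_distrib)
  qed
  have e2: "(- x$2 * V)\<^sup>2 = (v02 * r)\<^sup>2"
  proof -
    have "(- x$2 * V)\<^sup>2 = (x$2 * v01)\<^sup>2 + (x$2 * v02)\<^sup>2"
      using V_sq by (simp add: power_mult_distrib algebra_simps)
    also have "\<dots> = v02\<^sup>2 * ((x$1)\<^sup>2 + (x$2)\<^sup>2)"
      unfolding w by (simp add: power_mult_distrib algebra_simps)
    finally show ?thesis by (simp add: h power_mult_distrib)
  qed
  have "- x$1 * V = v01 * r"
    by (rule power2_eq_imp_eq[OF e1]) (use neg r v V_pos in \<open>simp_all add: mult_nonpos_nonneg\<close>)
  moreover have "- x$2 * V = v02 * r"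
    by (rule power2_eq_imp_eq[OF e2]) (use neg r v V_pos in \<open>simp_all add: mult_nonpos_nonneg\<close>)
  ultimately show "x \<in> {xe}"
    using V_pos by (simp add: vec_eq_iff forall_2 x_eq_nth field_simps)
next
  fix x assume "x \<in> {xe}"
  then show "x \<in> {x \<in> negative_quadrant. h r x = 0} \<inter> {x. x$2 * v01 - x$1 * v02 = 0}"
    using h_x_eq transversal_x_eq x_eq_in_quadrant by (simp add: transversal_def)
qed

text \<open>Divided by the squared norm \<open>r\<^sup>2\<close>, this value is the expansion rate
  \<open>V / r\<close> in the tangential direction.\<close>

lemma transversal_clockwise_x_eq: "transversal v01 v02 (clockwise xe) = r * V"
proof -
  have "transversal v01 v02 (clockwise xe) = (v01\<^sup>2 + v02\<^sup>2) * r / V"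
    by (simp add: transversal_def x_eq_nth power2_eq_square add_divide_distrib algebra_simps)
  also have "\<dots> = r * V"
    unfolding V_sq[symmetric] using V_pos by (simp add: power2_eq_square)
  finally show ?thesis .
qed

section \<open>The Jacobian and its spectrum\<close>

lemma closed_loop_has_derivative_at_x_eq:
  "(closed_loop lam r v01 v02 has_derivative
     (\<lambda>d. (- (lam * (xe \<bullet> d) / r\<^sup>2)) *\<^sub>R xe
          + (transversal v01 v02 d / r\<^sup>2) *\<^sub>R clockwise xe)) (at xe)"
  using closed_loop_has_derivative_at_equilibrium[OF h_x_eq transversal_x_eq x_eq_nonzero]
  by (simp add: norm_x_eq)

text \<open>Uniqueness of the derivative gives the action of the Jacobian on vectors, so its matrix
  entries never have to be computed.\<close>

lemma jacobian_x_eq_mult: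
  "jacobian (closed_loop lam r v01 v02) (at xe) *v d =
     (- (lam * (xe \<bullet> d) / r\<^sup>2)) *\<^sub>R xe + (transversal v01 v02 d / r\<^sup>2) *\<^sub>R clockwise xe"
proof -
  note D = closed_loop_has_derivative_at_x_eq[of lam]
  have "closed_loop lam r v01 v02 differentiable (at xe)"
    using D by (auto simp: differentiable_def)
  then have "(closed_loop lam r v01 v02 has_derivative
      (\<lambda>d. jacobian (closed_loop lam r v01 v02) (at xe) *v d)) (at xe)"
    using jacobian_works by blast
  from has_derivative_unique[OF this D] show ?thesis by (rule fun_cong)
qed

text \<open>The functionals given by the inner product with \<open>xe\<close> and by
  \<open>transversal\<close> are left eigenvectors for \<open>- lam\<close> and
  \<open>V / r\<close>. They have no common nonzero kernel vector, so every eigenvalue is one of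
  these two. Conversely, \<open>xe\<close> and \<open>clockwise xe\<close> are right
  eigenvectors.\<close>

lemma eigenvalues_x_eq:
  "{c. eigenvalue (jacobian (closed_loop lam r v01 v02) (at xe)) c}
     = {- lam, sqrt (v01\<^sup>2 + v02\<^sup>2) / r}"
  unfolding V_def[symmetric]
proof (intro equalityI subsetI)
  let ?A = "jacobian (closed_loop lam r v01 v02) (at xe)"
  have orth: "xe \<bullet> clockwise xe = 0"
    by (simp add: inner_vec_def sum_2)
  have xx: "xe \<bullet> xe = r\<^sup>2"
    by (simp add: power2_norm_eq_inner[symmetric] norm_x_eq)
  {
    fix c assume "c \<in> {c. eigenvalue ?A c}"
    then obtain d where d: "d \<noteq> 0" "?A *v d = c *\<^sub>R d"
      by (auto simp: eigenvalue_def scalar_mult_eq_scaleR)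
    note eq = d(2)[unfolded jacobian_x_eq_mult]
    have "- lam * (xe \<bullet> d) = c * (xe \<bullet> d)"
      using arg_cong[OF eq, of "\<lambda>y. xe \<bullet> y"] r by (simp add: inner_add_right inner_diff_right orth xx)
    moreover have "V / r * transversal v01 v02 d = c * transversal v01 v02 d"
      using arg_cong[OF eq, of "transversal v01 v02"] r
      by (simp add: linear_add[OF linear_transversal] linear_cmul[OF linear_transversal]
          linear_diff[OF linear_transversal]
          transversal_x_eq transversal_clockwise_x_eq power2_eq_square mult.commute)
    moreover have "xe \<bullet> d \<noteq> 0 \<or> transversal v01 v02 d \<noteq> 0"
    proof (rule ccontr)
      assume "\<not> ?thesis"
      moreover have "xe \<bullet> d = - (r / V) * (v01 * d$1 + v02 * d$2)"
        by (simp add: inner_vec_def sum_2 x_eq_nth algebra_simps)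
      ultimately have "v01 * d$1 + v02 * d$2 = 0" "d$2 * v01 - d$1 * v02 = 0"
        using r V_pos by (simp_all add: transversal_def)
      \<comment> \<open>Lagrange's identity: the components of \<open>d\<close> along the desired
        velocity and perpendicular to it determine the length of \<open>d\<close>.\<close>
      moreover have "V\<^sup>2 * (d$1)\<^sup>2 + V\<^sup>2 * (d$2)\<^sup>2
          = (v01 * d$1 + v02 * d$2)\<^sup>2 + (d$2 * v01 - d$1 * v02)\<^sup>2"
        unfolding V_sq by (simp add: power2_eq_square algebra_simps)
      ultimately have "V\<^sup>2 * ((d$1)\<^sup>2 + (d$2)\<^sup>2) = 0"
        by (simp add: distrib_left)
      then have "(norm d)\<^sup>2 = 0" using V_pos by (simp add: norm_power2_vec2)
      then show False using d(1) by simp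
    qed
    ultimately show "c \<in> {- lam, V / r}" by (metis insertCI mult_right_cancel)
  }
  fix c assume "c \<in> {- lam, V / r}"
  moreover have "?A *v xe = (- lam) *s xe"
    using r by (simp add: jacobian_x_eq_mult xx transversal_x_eq scalar_mult_eq_scaleR)
  moreover have "?A *v clockwise xe = (V / r) *s clockwise xe"
    using r by (simp add: jacobian_x_eq_mult orth transversal_clockwise_x_eq
        scalar_mult_eq_scaleR power2_eq_square)
  moreover have "clockwise xe \<noteq> 0"
    using x_eq_nonzero by (auto simp: vec_eq_iff forall_2)
  ultimately show "c \<in> {c. eigenvalue ?A c}"
    using x_eq_nonzero by (auto simp: eigenvalue_def)
qed

section \<open>Instability along the circle of radius \<open>r\<close>\<close>

text \<open>At angle \<open>\<phi>\<close> from \<open>x\<^sub>e\<close> on the circle \<open>h = 0\<close> the equation reads \<open>\<phi>' = (V/r) sin \<phi>\<close>;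
  it is solved by \<open>tan(\<phi>/2) = c exp(V t/r)\<close>.\<close>

lemma circle_solution:
  fixes c :: real
  defines "E \<equiv> \<lambda>t. c * exp (V / r * t)"
  defines "x \<equiv> \<lambda>t. ((1 - (E t)\<^sup>2) / (1 + (E t)\<^sup>2)) *\<^sub>R xe
                   + (2 * E t / (1 + (E t)\<^sup>2)) *\<^sub>R clockwise xe"
  shows "solves_on (closed_loop lam r v01 v02) phase_space x I"
  unfolding solves_on_def
proof
  fix t assume "t \<in> I"
  \<comment> \<open>With \<open>E\<close> as the tangent of the half angle, \<open>p\<close> and
    \<open>q\<close> are the cosine and sine of the angle from \<open>xe\<close>.\<close>
  define p where "p = (\<lambda>t. (1 - (E t)\<^sup>2) / (1 + (E t)\<^sup>2))"
  define q where "q = (\<lambda>t. 2 * E t / (1 + (E t)\<^sup>2))"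
  have nz: "1 + (E s)\<^sup>2 \<noteq> 0" for s
    by (metis add.commute sum_power2_eq_zero_iff power_one zero_neq_one)
  have pq: "(p t)\<^sup>2 + (q t)\<^sup>2 = 1"
  proof -
    have "(1 - (E t)\<^sup>2)\<^sup>2 + (2 * E t)\<^sup>2 = (1 + (E t)\<^sup>2)\<^sup>2"
      by (simp add: power2_eq_square algebra_simps)
    then show ?thesis using nz[of t]
      by (simp add: p_def q_def power_divide add_divide_distrib[symmetric])
  qed
  have Ed: "(E has_real_derivative V / r * E t) (at t within I)"
    unfolding E_def using r by (auto intro!: derivative_eq_intros)
  have pd: "(p has_real_derivative - (V / r * (q t)\<^sup>2)) (at t within I)"
    unfolding p_def q_def
    by (rule derivative_eq_intros Ed nz refl)+
      (use nz[of t] r in \<open>simp add: divide_simps, simp add: power2_eq_square algebra_simps\<close>)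
  have qd: "(q has_real_derivative V / r * p t * q t) (at t within I)"
    unfolding p_def q_def
    by (rule derivative_eq_intros Ed nz refl)+
      (use nz[of t] r in \<open>simp add: divide_simps, simp add: power2_eq_square algebra_simps\<close>)
  have x: "x = (\<lambda>t. p t *\<^sub>R xe + q t *\<^sub>R clockwise xe)"
    by (simp add: x_def p_def q_def)
  have cc: "clockwise (x t) = p t *\<^sub>R clockwise xe - q t *\<^sub>R xe"
    by (simp add: x vec_eq_iff forall_2)
  have n: "(norm (x t))\<^sup>2 = r\<^sup>2"
  proof -
    have "(norm (x t))\<^sup>2 = ((p t)\<^sup>2 + (q t)\<^sup>2) * (norm xe)\<^sup>2"
      unfolding norm_power2_vec2 by (simp add: x power2_eq_square algebra_simps)
    then show ?thesis by (simp add: pq norm_x_eq)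
  qed
  have w: "transversal v01 v02 (x t) = q t * (r * V)"
    by (simp add: x linear_add[OF linear_transversal] linear_cmul[OF linear_transversal]
        transversal_x_eq transversal_clockwise_x_eq)
  have f: "closed_loop lam r v01 v02 (x t)
      = (- (V / r * (q t)\<^sup>2)) *\<^sub>R xe + (V / r * p t * q t) *\<^sub>R clockwise xe"
    unfolding closed_loop_decomposition h_eq_norm n w cc
    using r by (simp add: scaleR_diff_right power2_eq_square algebra_simps)
  have "(x has_vector_derivative closed_loop lam r v01 v02 (x t)) (at t within I)"
    unfolding f unfolding x
    by (rule has_vector_derivative_eq_rhs) (rule derivative_intros pd qd | simp)+
  moreover have "x t \<noteq> 0" using n r by auto
  ultimately show "x t \<in> phase_space \<and>
      (x has_vector_derivative closed_loop lam r v01 v02 (x t)) (at t within I)"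
    by (simp add: phase_space_def)
qed

text \<open>Circle solutions with small \<open>c > 0\<close> start arbitrarily close to
  \<open>xe\<close>, yet later reach \<open>clockwise xe\<close>, at distance \<surd>2 times
  \<open>r\<close>. Stability thus already fails for \<epsilon> = \<open>r\<close>.\<close>

lemma unstable_x_eq:
  assumes "lam > 0"
  shows "unstable_equilibrium (closed_loop lam r v01 v02) phase_space xe"
proof -
  let ?f = "closed_loop lam r v01 v02"
  have eq: "equilibrium ?f phase_space xe"
    using equilibrium_closed_loop_iff[OF assms x_eq_nonzero] h_x_eq transversal_x_eq by simp
  have "\<not> stable_equilibrium ?f phase_space xe"
  proof
    assume "stable_equilibrium ?f phase_space xe"
    then obtain \<delta> where \<delta>: "\<delta> > 0" and
      st: "\<And>T x t. T > 0 \<Longrightarrow> solves_on ?f phase_space x {0..T} \<Longrightarrow> dist (x 0) xe < \<delta> \<Longrightarrow>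
        t \<in> {0..T} \<Longrightarrow> dist (x t) xe < r"
      using r unfolding stable_equilibrium_def by metis
    define x0 where "x0 = (\<lambda>c::real. ((1 - c\<^sup>2) / (1 + c\<^sup>2)) *\<^sub>R xe
                   + (2 * c / (1 + c\<^sup>2)) *\<^sub>R clockwise xe)"
    have "isCont x0 0"
      unfolding x0_def by (intro continuous_intros) auto
    then have "(x0 \<longlongrightarrow> xe) (at 0)"
      by (simp add: isCont_def x0_def)
    then have "\<forall>\<^sub>F c in at 0. dist (x0 c) xe < \<delta>"
      using \<delta> by (rule tendstoD)
    \<comment> \<open>The value \<open>c = 0\<close> gives the constant solution, so
      \<open>c\<close> is taken strictly positive; \<open>c < 1\<close> makes the travel time
      positive.\<close>
    then have "\<forall>\<^sub>F c in at_right 0. dist (x0 c) xe < \<delta>"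
      by (rule filter_leD[OF at_le, rotated]) simp
    moreover have "\<forall>\<^sub>F c in at_right 0. c \<in> {0<..<1::real}"
      by (rule eventually_at_right_real) simp
    ultimately have "\<forall>\<^sub>F c in at_right 0. dist (x0 c) xe < \<delta> \<and> c \<in> {0<..<1::real}"
      by (rule eventually_conj)
    then obtain c where c: "dist (x0 c) xe < \<delta>" "0 < c" "c < 1"
      using eventually_happens'[OF trivial_limit_at_right_real[of "0::real"]] by auto
    define x where "x = (\<lambda>t. x0 (c * exp (V / r * t)))"
    \<comment> \<open>The time at which the half-angle tangent equals 1, that is, after a quarter
      turn.\<close>
    define T where "T = - ln c * r / V"
    have T: "T > 0" unfolding T_def using c r V_pos by (intro divide_pos_pos mult_pos_pos) auto
    have sol: "solves_on ?f phase_space x {0..T}"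
      using circle_solution[of lam c "{0..T}"] by (simp add: x_def x0_def)
    have "c * exp (V / r * T) = 1"
      unfolding T_def using c r V_pos by (simp add: exp_minus)
    then have "x T = clockwise xe" by (simp add: x_def x0_def)
    then have "(dist (x T) xe)\<^sup>2 = 2 * (norm xe)\<^sup>2"
      unfolding dist_norm norm_power2_vec2 by (simp add: power2_eq_square algebra_simps)
    then have "(dist (x T) xe)\<^sup>2 \<ge> r\<^sup>2"
      by (simp add: norm_x_eq)
    then have "dist (x T) xe \<ge> r"
      using r by (simp add: power2_le_iff_abs_le)
    moreover have "dist (x T) xe < r"
      using T c by (intro st[OF T sol]) (auto simp: x_def)
    ultimately show False by simp
  qed
  with eq show ?thesis by (simp add: unstable_equilibrium_def)
qed

section \<open>Confinement of the stable set to a line\<close>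

lemma converges_imp_transversal_zero:
  assumes "converges_from (closed_loop lam r v01 v02) phase_space x0 xe"
  shows "transversal v01 v02 x0 = 0"
proof -
  let ?f = "closed_loop lam r v01 v02"
  obtain x where nz: "\<And>t. t \<ge> 0 \<Longrightarrow> x t \<noteq> 0"
    and xd: "\<And>t. t \<ge> 0 \<Longrightarrow> (x has_vector_derivative ?f (x t)) (at t within {0..})"
    and x0: "x 0 = x0" and lim: "(x \<longlongrightarrow> xe) at_top"
    using assms unfolding converges_from_def solves_on_def phase_space_def by auto
  define w where "w = (\<lambda>t. transversal v01 v02 (x t))"
  \<comment> \<open>The growth rate of \<open>w\<close>: the first term comes from the radial part
    of the field, the second from the tangential part.\<close>
  define b where "b = (\<lambda>y::real^2. - (lam * h r y / (2 * (norm y)\<^sup>2))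
    - (y$1 * v01 + y$2 * v02) / (norm y)\<^sup>2)"
  have tc: "transversal v01 v02 (clockwise y) = - (y$1 * v01 + y$2 * v02)" for y
    by (simp add: transversal_def)
  have trf: "transversal v01 v02 (?f y) = b y * transversal v01 v02 y" for y
    unfolding closed_loop_decomposition b_def
    by (simp add: linear_add[OF linear_transversal] linear_cmul[OF linear_transversal]
        linear_diff[OF linear_transversal] tc algebra_simps add_divide_distrib)
  have wd: "(w has_real_derivative b (x t) * w t) (at t within {0..})" if "t \<ge> 0" for t
    using bounded_linear.has_vector_derivative[OF
        linear_conv_bounded_linear[THEN iffD1, OF linear_transversal] xd[OF that], of v01 v02]
    by (simp add: w_def trf has_real_derivative_iff_has_vector_derivative)
  have contx: "continuous_on {0..} x"
    using xd by (intro continuous_on_vector_derivative) auto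
  have contb: "continuous_on {0..} (\<lambda>t. b (x t))"
    unfolding b_def h_eq_norm
    by (intro continuous_intros contx) (use nz in auto)
  text \<open>\<open>m = 0\<close> serves near \<open>x\<^sub>e\<close>, where \<open>b > 0\<close>; a large \<open>m\<close> carries \<open>w = 0\<close> back to time \<open>0\<close>.\<close>
  have mono: "exp (2 * m * s) * (w s)\<^sup>2 \<le> exp (2 * m * t) * (w t)\<^sup>2"
    if "0 \<le> s" "s \<le> t" "\<And>u. s \<le> u \<Longrightarrow> u \<le> t \<Longrightarrow> - m \<le> b (x u)" for m s t
  proof (rule DERIV_nonneg_imp_increasing_open[OF that(2), where
      f = "\<lambda>t. exp (2 * m * t) * (w t)\<^sup>2"])
    fix u assume u: "s < u" "u < t"
    \<comment> \<open>At interior times the one-sided derivative is a two-sided one, as the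
      monotonicity rule requires.\<close>
    then have "u > 0" using that(1) by simp
    then have "(w has_real_derivative b (x u) * w u) (at u)"
      using wd[of u] at_within_interior[of u "{0..}"] by simp
    \<comment> \<open>The exponential shifts the growth rate of the square from \<open>2 * b\<close>
      to \<open>2 * (m + b)\<close>, which is nonnegative once \<open>b\<close> is at least
      \<open>- m\<close>.\<close>
    then have "((\<lambda>t. exp (2 * m * t) * (w t)\<^sup>2) has_real_derivative
        2 * (m + b (x u)) * (exp (2 * m * u) * (w u)\<^sup>2)) (at u)"
      by (auto intro!: derivative_eq_intros simp: power2_eq_square algebra_simps)
    moreover have "0 \<le> 2 * (m + b (x u)) * (exp (2 * m * u) * (w u)\<^sup>2)"
      using that(3)[of u] u by simp
    ultimately show "\<exists>y. ((\<lambda>t. exp (2 * m * t) * (w t)\<^sup>2) has_real_derivative y) (at u) \<and> 0 \<le> y"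
      by blast
  next
    have "continuous_on {0..} w"
      unfolding w_def transversal_def by (intro continuous_intros contx)
    then have "continuous_on {s..t} w"
      by (rule continuous_on_subset) (use that in auto)
    then show "continuous_on {s..t} (\<lambda>t. exp (2 * m * t) * (w t)\<^sup>2)"
      by (intro continuous_intros)
  qed
  have blim: "((\<lambda>t. b (x t)) \<longlongrightarrow> V / r) at_top"
  proof -
    have "xe$1 * v01 + xe$2 * v02 = - ((v01\<^sup>2 + v02\<^sup>2) * r / V)"
      by (simp add: x_eq_nth power2_eq_square add_divide_distrib algebra_simps)
    also have "\<dots> = - (r * V)"
      unfolding V_sq[symmetric] using V_pos by (simp add: power2_eq_square)
    finally have "b xe = V / r"
      using r by (simp add: b_def h_x_eq norm_x_eq power2_eq_square)
    moreover have "((\<lambda>t. b (x t)) \<longlongrightarrow> b xe) at_top"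
      unfolding b_def h_eq_norm by (intro tendsto_intros lim) (use x_eq_nonzero in auto)
    ultimately show ?thesis by simp
  qed
  have "\<forall>\<^sub>F t in at_top. b (x t) > 0"
    by (rule order_tendstoD(1)[OF blim]) (use r V_pos in simp)
  then obtain N where N: "\<And>t. t \<ge> N \<Longrightarrow> b (x t) > 0"
    by (auto simp: eventually_at_top_linorder)
  \<comment> \<open>The maximum with 0 keeps \<open>T\<close> within the time domain of the
    solution.\<close>
  define T where "T = max 0 N"
  have wlim: "((\<lambda>t. (w t)\<^sup>2) \<longlongrightarrow> 0) at_top"
  proof -
    have "(w \<longlongrightarrow> transversal v01 v02 xe) at_top"
      unfolding w_def transversal_def by (intro tendsto_intros lim)
    from tendsto_power[OF this, of 2] show ?thesis by (simp add: transversal_x_eq)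
  qed
  \<comment> \<open>From \<open>T\<close> on the square of \<open>w\<close> is nondecreasing, so its
    limit 0 bounds its value at \<open>T\<close> from above.\<close>
  have "(w T)\<^sup>2 \<le> 0"
  proof (rule tendsto_lowerbound[OF wlim])
    show "\<forall>\<^sub>F t in at_top. (w T)\<^sup>2 \<le> (w t)\<^sup>2"
      using mono[of T _ 0] N
      by (intro eventually_at_top_linorderI[of T]) (auto simp: T_def less_imp_le)
  qed simp
  then have wT: "w T = 0" by simp
  \<comment> \<open>Before \<open>T\<close> the rate \<open>b\<close> may be negative, but
    continuity on a compact interval bounds it. This supplies the \<open>m\<close> with which
    \<open>w T = 0\<close> forces \<open>w 0 = 0\<close>.\<close>
  have "compact ((\<lambda>t. b (x t)) ` {0..T})"
    by (intro compact_continuous_image continuous_on_subset[OF contb]) auto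
  then obtain m where m: "\<And>t. t \<in> {0..T} \<Longrightarrow> \<bar>b (x t)\<bar> \<le> m"
    using compact_imp_bounded bounded_real by (metis (no_types, lifting) image_eqI)
  have "(w 0)\<^sup>2 \<le> 0"
    using mono[of 0 T m] m wT by (force simp: T_def)
  then show ?thesis by (simp add: w_def x0)
qed

end

theorem mainTheorem3:
  fixes lam r v01 v02 :: real
  assumes "lam > 0" and "r > 0" and "v01 > 0" and "v02 > 0"
  shows
    "{x \<in> negative_quadrant. equilibrium (closed_loop lam r v01 v02) phase_space x}
       = {x \<in> negative_quadrant. h r x = 0} \<inter> {x. x$2 * v01 - x$1 * v02 = 0}
     \<and> {x \<in> negative_quadrant. h r x = 0} \<inter> {x. x$2 * v01 - x$1 * v02 = 0}
       = {x_eq r v01 v02}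
     \<and> closed_loop lam r v01 v02 differentiable (at (x_eq r v01 v02))
     \<and> {c. eigenvalue (jacobian (closed_loop lam r v01 v02) (at (x_eq r v01 v02))) c}
       = {- lam, sqrt (v01\<^sup>2 + v02\<^sup>2) / r}
     \<and> sqrt (v01\<^sup>2 + v02\<^sup>2) / r > 0
     \<and> unstable_equilibrium (closed_loop lam r v01 v02) phase_space (x_eq r v01 v02)
     \<and> {x0 \<in> negative_quadrant.
          converges_from (closed_loop lam r v01 v02) phase_space x0 (x_eq r v01 v02)}
       \<in> null_sets lebesgue"
proof (intro conjI)
  show "{x \<in> negative_quadrant. equilibrium (closed_loop lam r v01 v02) phase_space x}
       = {x \<in> negative_quadrant. h r x = 0} \<inter> {x. x$2 * v01 - x$1 * v02 = 0}"
  proof -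
    have "x \<noteq> 0" if "x \<in> negative_quadrant" for x
      using that by (auto simp: negative_quadrant_def)
    then show ?thesis
      using equilibrium_closed_loop_iff[OF assms(1), of _ r v01 v02]
      by (auto simp: transversal_def)
  qed
  show "closed_loop lam r v01 v02 differentiable (at (x_eq r v01 v02))"
    using closed_loop_has_derivative_at_x_eq[OF assms(2-4)] by (auto simp: differentiable_def)
  show "sqrt (v01\<^sup>2 + v02\<^sup>2) / r > 0"
    using assms by (simp add: add_pos_pos)
  \<comment> \<open>The stable set lies in the line \<open>transversal v01 v02 x = 0\<close>,
    written as a hyperplane with nonzero normal vector.\<close>
  have "negligible {x::real^2. vector [- v02, v01] \<bullet> x = 0}"
    by (rule negligible_hyperplane) (use assms in \<open>auto simp: vec_eq_iff forall_2\<close>)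
  then have "negligible {x0 \<in> negative_quadrant.
      converges_from (closed_loop lam r v01 v02) phase_space x0 (x_eq r v01 v02)}"
    by (rule negligible_subset)
      (use converges_imp_transversal_zero[OF assms(2-4)] in
        \<open>auto simp: transversal_def inner_vec_def sum_2 algebra_simps\<close>)
  then show "{x0 \<in> negative_quadrant.
      converges_from (closed_loop lam r v01 v02) phase_space x0 (x_eq r v01 v02)}
       \<in> null_sets lebesgue"
    by (simp add: negligible_iff_null_sets)
qed (use assms equilibrium_unique eigenvalues_x_eq unstable_x_eq in auto)

end
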